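(* Let $\mathcal{L}:[0,1]\to[0,1]$ be the Lüroth map. For every $x\in[0,1]$, the set $\operatorname{D}_{\mathcal{L}}(x)$ is dense in $[0,1]$. Moreover, $\mathfrak{m}(\operatorname{D}_{\mathcal{L}}(x))=0$ and $\dim_{\mathrm H}(\operatorname{D}_{\mathcal{L}}(x))=1$.
   Context: For $x\in(0,1]$, $a_1(x)$ is the unique integer $\ge 2$ with $\frac{1}{a_1(x)}<x\le\frac{1}{a_1(x)-1}$. The Lüroth map $\mathcal{L}:[0,1]\to[0,1]$ is $\mathcal{L}(x)=a_1(x)(a_1(x)-1)x-(a_1(x)-1)$ for $x\in(0,1]$ and $\mathcal{L}(0)=0$; $\mathcal{L}^n$ is its $n$-th iterate. For $x\in[0,1]$, $\operatorname{D}_{\mathcal{L}}(x)$ is the set of $y\in[0,1]$ with $y\neq x$ such that $\liminf_{n\to\infty}|\mathcal{L}^n(x)-\mathcal{L}^n(y)|>0$ (distal pairs). $\mathfrak{m}$ is Lebesgue measure on $[0,1]$ and $\dim_{\mathrm H}$ is Hausdorff dimension. *)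

theory Defs
  imports "HOL-Analysis.Analysis"
begin

definition luroth_digit :: "real \<Rightarrow> int" where
  "luroth_digit x = (THE a. a \<ge> 2 \<and> 1 / real_of_int a < x \<and> x \<le> 1 / (real_of_int a - 1))"

lemma luroth_digit_ex1:
  fixes x :: real
  assumes "0 < x" "x \<le> 1"
  shows "\<exists>!a::int. a \<ge> 2 \<and> 1 / real_of_int a < x \<and> x \<le> 1 / (real_of_int a - 1)"
proof -
  have *: "(a \<ge> 2 \<and> 1 / real_of_int a < x \<and> x \<le> 1 / (real_of_int a - 1)) \<longleftrightarrow> a = \<lfloor>1 / x\<rfloor> + 1" for a :: int
  proof -
    have "1 / x \<ge> 1" using assms by simp
    then have ge: "\<lfloor>1 / x\<rfloor> \<ge> 1" by (simp add: le_floor_iff)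
    have "(1 / real_of_int a < x \<and> x \<le> 1 / (real_of_int a - 1)) \<longleftrightarrow> \<lfloor>1 / x\<rfloor> = a - 1" if "a \<ge> 2"
    proof -
      have "real_of_int a > 1" using that by linarith
      then have "1 / real_of_int a < x \<longleftrightarrow> 1 / x < real_of_int a"
        and "x \<le> 1 / (real_of_int a - 1) \<longleftrightarrow> real_of_int a - 1 \<le> 1 / x"
        using assms by (simp_all add: field_simps)
      then show ?thesis by (auto simp: floor_eq_iff)
    qed
    then show ?thesis using ge by (cases "a \<ge> 2") auto
  qed
  show ?thesis unfolding * by simp
qed

definition luroth_map :: "real \<Rightarrow> real" where
  "luroth_map x =
     (if x \<in> {0<..1} then
        (let a = real_of_int (luroth_digit x) in a * (a - 1) * x - (a - 1))
      else 0)"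

lemma luroth_map_in_unit_interval: "luroth_map x \<in> {0..1}"
proof (cases "x \<in> {0<..1}")
  case True
  define a where "a = real_of_int (luroth_digit x)"
  have "luroth_digit x \<ge> 2 \<and> 1 / a < x \<and> x \<le> 1 / (a - 1)"
    unfolding a_def luroth_digit_def
    by (rule theI'[OF luroth_digit_ex1]) (use True in auto)
  then have a: "a > 1" "a * x > 1" "(a - 1) * x \<le> 1"
    unfolding a_def by (auto simp: field_simps)
  have "0 \<le> (a - 1) * (a * x - 1)" using a by simp
  moreover have "a * ((a - 1) * x) \<le> a * 1" using a by (intro mult_left_mono) auto
  ultimately show ?thesis
    using True by (simp add: luroth_map_def Let_def a_def[symmetric] algebra_simps)
qed (simp only: luroth_map_def if_False atLeastAtMost_iff, simp)

text \<open>The lower limit is taken in the extended reals, since type \<^typ>\<open>real\<close> is not a complete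
  lattice.\<close>

definition luroth_distal :: "real \<Rightarrow> real set" where
  "luroth_distal x =
     {y \<in> {0..1}. y \<noteq> x \<and>
        liminf (\<lambda>n. ereal \<bar>(luroth_map ^^ n) x - (luroth_map ^^ n) y\<bar>) > 0}"

text \<open>The conventions are \<open>(diam U)\<^sup>0 = 1\<close> for nonempty \<open>U\<close> (whereas \<open>0 powr 0 = 0\<close> in HOL) and
  weight \<open>0\<close> for the empty set, so that \<open>0\<close>-dimensional Hausdorff measure is counting measure
  and countable covers include finite ones.\<close>

definition diam_weight :: "real \<Rightarrow> 'a::metric_space set \<Rightarrow> ennreal" where
  "diam_weight s U = (if U = {} then 0 else if s = 0 then 1 else ennreal (diameter U powr s))"

text \<open>Covering sets are required to be bounded because \<^const>\<open>diameter\<close> is real-valued and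
  meaningless on unbounded sets.\<close>

definition hausdorff_premeasure :: "real \<Rightarrow> real \<Rightarrow> 'a::metric_space set \<Rightarrow> ennreal" where
  "hausdorff_premeasure s \<delta> A =
     Inf {(\<Sum>i. diam_weight s (U i)) | U :: nat \<Rightarrow> 'a set.
            A \<subseteq> (\<Union>i. U i) \<and> (\<forall>i. bounded (U i) \<and> diameter (U i) \<le> \<delta>)}"

definition hausdorff_outer_measure :: "real \<Rightarrow> 'a::metric_space set \<Rightarrow> ennreal" where
  "hausdorff_outer_measure s A = (SUP \<delta>\<in>{0<..}. hausdorff_premeasure s \<delta> A)"

definition hausdorff_dim :: "'a::metric_space set \<Rightarrow> ennreal" where
  "hausdorff_dim A = Inf {ennreal s | s. s \<ge> 0 \<and> hausdorff_outer_measure s A = 0}"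

end

theory Submission
  imports Defs "HOL-Real_Asymp.Real_Asymp"
begin

text \<open>
  Null set: on every cylinder of level \<open>k\<close> the map \<open>L\<^sup>k\<close> is affine onto \<open>(0,1]\<close>. Let
  \<open>\<alpha>\<close> be the supremum over \<open>x\<close> of the measure of those \<open>y\<close> whose orbit always keeps distance at least
  \<open>e\<close> from the orbit of \<open>x\<close>. Such \<open>y\<close> avoid all short cylinders close to \<open>x\<close>, and in each of
  the others they have relative measure at most \<open>\<alpha>\<close>; hence \<open>\<alpha> \<le> \<alpha> (1 - d)\<close> for some
  \<open>d > 0\<close>, that is \<open>\<alpha> = 0\<close>.

  Dimension: for \<open>s < 1\<close> there are a bound \<open>M\<close> and a set of \<open>N\<close> digit words over
  \<open>{2..M}\<close>, all of the same length, whose cylinders have one common diameter \<open>1/R\<close>, with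
  \<open>N \<ge> (12 R)\<^sup>s\<close>. Concatenate such words freely, but after each word insert a digit 3 or 4 that
  differs from the corresponding digit of \<open>x\<close>. Bounded digits and the absence of long runs
  of the digit 2 keep the orbit of the resulting point \<open>y\<close> away from the endpoints of the branch
  intervals, so that the inserted digits make \<open>(x, y)\<close> distal. Coding the choice of words by base
  \<open>N\<close> expansions gives a map \<open>g\<close> from \<open>[0,1)\<close> into the distal set with
  \<open>C |t - t'| \<le> |g t - g t'|\<^sup>s\<close>, whence the \<open>s\<close>-dimensional Hausdorff measure is positive.

  Density follows from the existence of distal points for every \<open>x\<close>, by pulling back along inverse
  branches.
\<close>

section \<open>Inverse branches of the Lueroth map\<close>

definition luroth_slope :: "nat \<Rightarrow> real" where
  "luroth_slope a = real a * (real a - 1)"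

text \<open>The solution \<open>y\<close> of \<open>a (a - 1) y - (a - 1) = z\<close>. Here
  \<open>1 / a\<close> is the excluded left endpoint of the branch interval of digit
  \<open>a\<close>, and \<open>1 / luroth_slope a\<close> is its length.\<close>

definition luroth_inv :: "nat \<Rightarrow> real \<Rightarrow> real" where
  "luroth_inv a z = 1 / real a + z / luroth_slope a"

lemma luroth_slope_ge2: "a \<ge> 2 \<Longrightarrow> luroth_slope a \<ge> 2"
  using mult_mono[of 2 "real a" 1 "real a - 1"] by (auto simp: luroth_slope_def)

lemma luroth_slope_pos: "a \<ge> 2 \<Longrightarrow> luroth_slope a > 0"
  using luroth_slope_ge2[of a] by linarith

lemma luroth_slope_mono: "2 \<le> a \<Longrightarrow> a \<le> b \<Longrightarrow> luroth_slope a \<le> luroth_slope b"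
  unfolding luroth_slope_def by (intro mult_mono) auto

lemma luroth_inv_1: "a \<ge> 2 \<Longrightarrow> luroth_inv a 1 = 1 / (real a - 1)"
  by (simp add: luroth_inv_def luroth_slope_def field_simps)

lemma luroth_inv_diff: "luroth_inv a z - luroth_inv a z' = (z - z') / luroth_slope a"
  by (simp add: luroth_inv_def diff_divide_distrib)

lemma luroth_inv_image:
  assumes "a \<ge> 2"
  shows "luroth_inv a ` {0<..1} = {1 / real a <.. 1 / (real a - 1)}"
proof -
  have q: "luroth_slope a > 0" using luroth_slope_pos[OF assms] .
  have "luroth_inv a ` {0<..1} = {1 / real a <.. luroth_inv a 1}"
  proof safe
    fix y assume y: "y \<in> {1 / real a <.. luroth_inv a 1}"
    then have "y = luroth_inv a (luroth_slope a * (y - 1 / real a))"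
      using q by (simp add: luroth_inv_def)
    moreover have "luroth_slope a * (y - 1 / real a) \<in> {0<..1}"
      using y q mult_left_mono[of "y - 1 / real a" "1 / luroth_slope a" "luroth_slope a"]
      by (auto simp: luroth_inv_def intro!: mult_pos_pos)
    ultimately show "y \<in> luroth_inv a ` {0<..1}" by blast
  qed (use q in \<open>auto simp: luroth_inv_def divide_right_mono\<close>)
  with luroth_inv_1[OF assms] show ?thesis by simp
qed

lemma luroth_inv_bounds:
  assumes "a \<ge> 2" "z \<in> {0<..1}"
  shows "1 / real a < luroth_inv a z" "luroth_inv a z \<le> 1 / (real a - 1)"
    "luroth_inv a z \<in> {0<..1}"
proof -
  have "luroth_inv a z \<in> {1 / real a <.. 1 / (real a - 1)}"
    using luroth_inv_image[OF assms(1)] assms(2) by blast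
  then show 1: "1 / real a < luroth_inv a z" and 2: "luroth_inv a z \<le> 1 / (real a - 1)" by auto
  have "1 / (real a - 1) \<le> 1" "0 < 1 / real a" using assms by auto
  with 1 2 show "luroth_inv a z \<in> {0<..1}" unfolding greaterThanAtMost_iff by linarith
qed

text \<open>Trades the definite description for a floor expression, from which Borel measurability
  of \<open>luroth_map\<close> follows.\<close>

lemma luroth_digit_eq_floor: "x \<in> {0<..1} \<Longrightarrow> luroth_digit x = \<lfloor>1 / x\<rfloor> + 1"
proof -
  assume x: "x \<in> {0<..1}"
  let ?a = "\<lfloor>1 / x\<rfloor> + 1"
  have ge: "\<lfloor>1 / x\<rfloor> \<ge> 1" using x by (simp add: le_floor_iff)
  have a: "1 / x < real_of_int ?a" "real_of_int ?a - 1 \<le> 1 / x" by (auto; linarith)+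
  then have "?a \<ge> 2 \<and> 1 / real_of_int ?a < x \<and> x \<le> 1 / (real_of_int ?a - 1)"
  proof -
    define b where "b = real_of_int \<lfloor>1 / x\<rfloor>"
    have "1 \<le> b" "1 / x < b + 1" "b \<le> 1 / x" using ge a by (auto simp: b_def)
    then have "1 / (b + 1) < x" "x \<le> 1 / b"
      using x by (simp_all add: field_simps)
    then show ?thesis using ge by (simp add: b_def)
  qed
  then show ?thesis
    unfolding luroth_digit_def
    by (intro the1_equality[OF luroth_digit_ex1]) (use x in auto)
qed

lemma luroth_digit_inv:
  assumes "a \<ge> 2" "z \<in> {0<..1}"
  shows "luroth_digit (luroth_inv a z) = int a"
  unfolding luroth_digit_def
  by (intro the1_equality[OF luroth_digit_ex1])
     (use luroth_inv_bounds[OF assms] assms in auto)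

lemma luroth_map_inv:
  assumes "a \<ge> 2" "z \<in> {0<..1}"
  shows "luroth_map (luroth_inv a z) = z"
proof -
  have "luroth_map (luroth_inv a z) = luroth_slope a * luroth_inv a z - (real a - 1)"
    using luroth_inv_bounds(3)[OF assms] luroth_digit_inv[OF assms]
    by (simp add: luroth_map_def luroth_slope_def Let_def)
  also have "luroth_slope a * luroth_inv a z = luroth_slope a / real a + z"
    using luroth_slope_pos[OF assms(1)] by (simp add: luroth_inv_def algebra_simps)
  also have "luroth_slope a / real a = real a - 1"
    using assms by (simp add: luroth_slope_def)
  finally show ?thesis by simp
qed

lemma luroth_inv_cases:
  assumes "y \<in> {0<..1}"
  obtains a z where "a \<ge> 2" "z \<in> {0<..1}" "y = luroth_inv a z"
proof -
  obtain b :: int where b: "b \<ge> 2" "1 / real_of_int b < y" "y \<le> 1 / (real_of_int b - 1)"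
    using luroth_digit_ex1[of y] assms by auto
  have "y \<in> {1 / real (nat b) <.. 1 / (real (nat b) - 1)}" using b by simp
  also have "\<dots> = luroth_inv (nat b) ` {0<..1}"
    using b by (subst luroth_inv_image) auto
  finally show ?thesis using that[of "nat b"] b by auto
qed

lemma luroth_inv_inj:
  assumes "a \<ge> 2" "z \<in> {0<..1}" "b \<ge> 2" "z' \<in> {0<..1}" "luroth_inv a z = luroth_inv b z'"
  shows "a = b"
  using luroth_digit_inv[OF assms(1,2)] luroth_digit_inv[OF assms(3,4)] assms(5) by simp

lemma luroth_branch_disjoint:
  assumes "a \<ge> 2" "b \<ge> 2" "a \<noteq> b" "y \<in> luroth_inv a ` {0<..1}"
  shows "y \<notin> luroth_inv b ` {0<..1}"
  using assms luroth_inv_inj by blast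

lemma luroth_map_0 [simp]: "luroth_map 0 = 0"
  by (simp add: luroth_map_def)

text \<open>Each branch maps onto (0,1], so a positive point never falls to the fixed point
  0.\<close>

lemma luroth_map_pos:
  assumes "y \<in> {0<..1}"
  shows "luroth_map y \<in> {0<..1}"
proof -
  obtain a z where "a \<ge> 2" "z \<in> {0<..1}" "y = luroth_inv a z"
    using luroth_inv_cases[OF assms] .
  then show ?thesis by (simp add: luroth_map_inv)
qed

lemma luroth_map_funpow_unit: "x \<in> {0..1} \<Longrightarrow> (luroth_map ^^ n) x \<in> {0..1}"
  by (cases n) (use luroth_map_in_unit_interval in auto)

lemma measurable_luroth_map [measurable]: "luroth_map \<in> borel_measurable borel"
proof -
  have "luroth_map = (\<lambda>x. if x \<in> {0<..1} then
      let a = real_of_int (\<lfloor>1 / x\<rfloor> + 1) in a * (a - 1) * x - (a - 1) else 0)"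
    by (auto simp: luroth_map_def luroth_digit_eq_floor fun_eq_iff)
  moreover have "\<dots> \<in> borel_measurable borel" unfolding Let_def by measurable
  ultimately show ?thesis by simp
qed

lemma measurable_luroth_map_funpow [measurable]: "luroth_map ^^ n \<in> borel_measurable borel"
  by (induction n) (auto intro: measurable_compose[OF _ measurable_luroth_map] simp: comp_def id_def)

section \<open>The distal set is a null set\<close>

lemma emeasure_luroth_branch:
  assumes [measurable]: "B \<in> sets borel" and a: "a \<ge> 2"
  shows "emeasure lborel (B \<inter> luroth_inv a ` {0<..1}) =
    ennreal (1 / luroth_slope a) * emeasure lborel {z \<in> {0<..1}. luroth_inv a z \<in> B}"
proof -
  have q: "luroth_slope a > 0" using luroth_slope_pos[OF a] .
  have inj: "luroth_inv a z \<in> luroth_inv a ` {0<..1} \<longleftrightarrow> z \<in> {0<..1}" for z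
    using q by (auto simp: luroth_inv_def)
  have [measurable]: "luroth_inv a ` {0<..1} \<in> sets borel"
    using luroth_inv_image[OF a] by simp
  have [measurable]: "luroth_inv a \<in> borel_measurable borel"
    unfolding luroth_inv_def by measurable
  have "emeasure lborel (B \<inter> luroth_inv a ` {0<..1}) =
      (\<integral>\<^sup>+ x. indicator (B \<inter> luroth_inv a ` {0<..1}) x \<partial>lborel)" by simp
  also have "\<dots> = ennreal \<bar>1 / luroth_slope a\<bar> *
      (\<integral>\<^sup>+ x. indicator (B \<inter> luroth_inv a ` {0<..1}) (1 / real a + 1 / luroth_slope a * x) \<partial>lborel)"
    using q by (intro nn_integral_real_affine) auto
  also have "(\<lambda>x. indicator (B \<inter> luroth_inv a ` {0<..1}) (1 / real a + 1 / luroth_slope a * x)) =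
      (indicator {z \<in> {0<..1}. luroth_inv a z \<in> B} :: real \<Rightarrow> ennreal)"
    using inj by (auto simp: fun_eq_iff luroth_inv_def indicator_def)
  finally show ?thesis using q by simp
qed

text \<open>The branch intervals partition (0,1], and on each of them the affine change of variables
  applies. The shift by 2 is there because digits start at 2.\<close>

lemma emeasure_luroth_sum:
  assumes "B \<in> sets borel" "B \<subseteq> {0<..1}"
  shows "emeasure lborel B =
    (\<Sum>n. ennreal (1 / luroth_slope (n + 2)) * emeasure lborel {z \<in> {0<..1}. luroth_inv (n + 2) z \<in> B})"
proof -
  let ?J = "\<lambda>n. B \<inter> luroth_inv (n + 2) ` {0<..1}"
  have meas: "?J n \<in> sets lborel" for n
    using assms(1) by (subst luroth_inv_image) auto
  have "B = (\<Union>n. ?J n)"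
  proof safe
    fix y assume y: "y \<in> B"
    then obtain a z where a: "a \<ge> 2" "z \<in> {0<..1}" "y = luroth_inv a z"
      using luroth_inv_cases assms(2) by blast
    with y have "y \<in> ?J (a - 2)" by (auto simp del: add_2_eq_Suc')
    then show "y \<in> (\<Union>n. ?J n)" by blast
  qed
  then have "emeasure lborel B = emeasure lborel (\<Union>n. ?J n)" by simp
  also have "\<dots> = (\<Sum>n. emeasure lborel (?J n))"
  proof (rule suminf_emeasure[symmetric])
    show "disjoint_family ?J"
      unfolding disjoint_family_on_def
      by (auto dest!: luroth_inv_inj[rotated -1])
  qed (use meas in auto)
  also have "\<dots> = (\<Sum>n. ennreal (1 / luroth_slope (n + 2)) *
      emeasure lborel {z \<in> {0<..1}. luroth_inv (n + 2) z \<in> B})"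
    using assms by (intro suminf_cong emeasure_luroth_branch) auto
  finally show ?thesis .
qed

text \<open>Every cylinder of level \<open>k\<close> has diameter at most \<open>2\<^sup>-\<^sup>k\<close>, so the last hypothesis keeps \<open>B\<close>
  out of all cylinders that meet \<open>G\<close>; within any other cylinder \<open>B\<close> is contained in a copy of
  \<open>A\<close> scaled to the length of the cylinder.\<close>
lemma emeasure_luroth_preimage_le:
  assumes "A \<in> sets borel" "B \<in> sets borel" "G \<in> sets borel" "B \<subseteq> {0<..1}"
    "\<And>y. y \<in> B \<Longrightarrow> (luroth_map ^^ k) y \<in> A"
    "\<And>y z. y \<in> B \<Longrightarrow> z \<in> G \<Longrightarrow> \<bar>y - z\<bar> \<ge> 1 / 2 ^ k"
  shows "emeasure lborel B \<le> emeasure lborel A * emeasure lborel ({0<..1} - G)"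
  using assms
proof (induction k arbitrary: B G)
  case 0
  show ?case
  proof (cases "B = {}")
    case False
    then obtain y where y: "y \<in> B" by auto
    have far: "\<bar>y - z\<bar> \<ge> 1" if "z \<in> G" for z using 0(6)[OF y that] by simp
    \<comment> \<open>A point of (0,1) has distance less than 1 from \<open>y\<close>, so
      \<open>G\<close> misses (0,1) altogether and the second factor is at least 1.\<close>
    have "{0<..<1} \<subseteq> {0<..1} - G"
      using far 0(4) y by fastforce
    then have "emeasure lborel {0<..<1::real} \<le> emeasure lborel ({0<..1} - G)"
      using 0 by (intro emeasure_mono) auto
    then have "1 \<le> emeasure lborel ({0<..1} - G)" by simp
    moreover have "emeasure lborel B \<le> emeasure lborel A"
      using 0 by (intro emeasure_mono) auto
    ultimately show ?thesis
      using mult_mono[of "emeasure lborel B" "emeasure lborel A" 1 "emeasure lborel ({0<..1} - G)"]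
      by simp
  qed simp
next
  case (Suc k)
  define B' where "B' n = {z \<in> {0<..1}. luroth_inv (n + 2) z \<in> B}" for n
  define G' where "G' n = {z \<in> {0<..1}. luroth_inv (n + 2) z \<in> G}" for n
  note [measurable] = Suc.prems(1-3)
  have [measurable]: "luroth_inv n \<in> borel_measurable borel" for n
    unfolding luroth_inv_def by measurable
  have meas: "B' n \<in> sets borel" "G' n \<in> sets borel" for n
    unfolding B'_def G'_def by measurable
  have le: "emeasure lborel (B' n) \<le> emeasure lborel A * emeasure lborel ({0<..1} - G' n)" for n
  proof (rule Suc.IH)
    fix y assume y: "y \<in> B' n"
    show "(luroth_map ^^ k) y \<in> A"
      using y Suc.prems(5)[of "luroth_inv (n + 2) y"] luroth_map_inv[of "n + 2" y]
      by (simp add: B'_def funpow_Suc_right del: funpow.simps)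
    fix z assume z: "z \<in> G' n"
    \<comment> \<open>Slopes are at least 2, so removing the first digit at least doubles the
      distance and turns the bound for \<open>Suc k\<close> into the one for
      \<open>k\<close>.\<close>
    have "1 / 2 ^ Suc k \<le> \<bar>luroth_inv (n + 2) y - luroth_inv (n + 2) z\<bar>"
      using y z Suc.prems(6) by (auto simp: B'_def G'_def simp del: power_Suc)
    also have "\<dots> = \<bar>y - z\<bar> / luroth_slope (n + 2)"
      using luroth_slope_pos[of "n + 2"] by (simp add: luroth_inv_diff)
    also have "\<dots> \<le> \<bar>y - z\<bar> / 2"
      using luroth_slope_ge2[of "n + 2"] by (intro divide_left_mono) auto
    finally show "1 / 2 ^ k \<le> \<bar>y - z\<bar>" by simp
  qed (use meas Suc.prems in \<open>auto simp: B'_def\<close>)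
  have G'_eq: "{z \<in> {0<..1}. luroth_inv (n + 2) z \<in> {0<..1} - G} = {0<..1} - G' n" for n
    using luroth_inv_bounds(3)[of "n + 2"] unfolding G'_def by fastforce
  have "emeasure lborel B = (\<Sum>n. ennreal (1 / luroth_slope (n + 2)) * emeasure lborel (B' n))"
    unfolding B'_def using Suc.prems by (intro emeasure_luroth_sum) auto
  also have "\<dots> \<le> (\<Sum>n. emeasure lborel A *
      (ennreal (1 / luroth_slope (n + 2)) * emeasure lborel ({0<..1} - G' n)))"
    proof (rule suminf_le)
    fix n
    have "ennreal (1 / luroth_slope (n + 2)) * emeasure lborel (B' n) \<le>
        ennreal (1 / luroth_slope (n + 2)) * (emeasure lborel A * emeasure lborel ({0<..1} - G' n))"
      by (intro mult_left_mono le) simp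
    then show "ennreal (1 / luroth_slope (n + 2)) * emeasure lborel (B' n) \<le>
        emeasure lborel A * (ennreal (1 / luroth_slope (n + 2)) * emeasure lborel ({0<..1} - G' n))"
      by (simp only: mult.left_commute)
  qed auto
  also have "\<dots> = emeasure lborel A *
      (\<Sum>n. ennreal (1 / luroth_slope (n + 2)) * emeasure lborel ({0<..1} - G' n))"
    by (rule ennreal_suminf_cmult)
  also have "(\<Sum>n. ennreal (1 / luroth_slope (n + 2)) * emeasure lborel ({0<..1} - G' n)) =
      emeasure lborel ({0<..1} - G)"
    unfolding G'_eq[symmetric] using Suc.prems by (intro emeasure_luroth_sum[symmetric]) auto
  finally show ?case .
qed

section \<open>Orbits that stay a fixed distance apart\<close>

definition luroth_apart :: "real \<Rightarrow> nat \<Rightarrow> real \<Rightarrow> real set" where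
  "luroth_apart e N x =
     {y \<in> {0<..1}. \<forall>n\<ge>N. \<bar>(luroth_map ^^ n) x - (luroth_map ^^ n) y\<bar> \<ge> e}"

lemma sets_luroth_apart [measurable]: "luroth_apart e N x \<in> sets borel"
  unfolding luroth_apart_def by measurable

lemma luroth_apart_funpow:
  assumes "y \<in> luroth_apart e N x"
  shows "(luroth_map ^^ k) y \<in> luroth_apart e (N - k) ((luroth_map ^^ k) x)"
proof -
  have "(luroth_map ^^ k) y \<in> {0<..1}" for k
    by (induction k) (use assms luroth_map_pos in \<open>auto simp: luroth_apart_def\<close>)
  moreover have "\<bar>(luroth_map ^^ n) ((luroth_map ^^ k) x) - (luroth_map ^^ n) ((luroth_map ^^ k) y)\<bar> \<ge> e"
    if "n \<ge> N - k" for n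
  proof -
    have "(luroth_map ^^ n) ((luroth_map ^^ k) z) = (luroth_map ^^ (n + k)) z" for z
      by (simp add: funpow_add)
    then show ?thesis using assms that by (simp add: luroth_apart_def)
  qed
  ultimately show ?thesis by (simp add: luroth_apart_def)
qed

lemma luroth_apart_subset: "luroth_apart e N x \<subseteq> {0<..1}"
  by (auto simp: luroth_apart_def)

lemma emeasure_luroth_apart_0:
  assumes e: "0 < e" and x: "x \<in> {0..1}"
  shows "emeasure lborel (luroth_apart e 0 x) = 0"
proof -
  \<comment> \<open>Since 2 d <= e, a point within d of \<open>x\<close> is at least d away from
    every \<open>y\<close> with |x - y| >= e. Since d <= 1/2, an interval of length d fits into
    (0,1] on one side of \<open>x\<close>.\<close>
  define d where "d = min e 1 / 2"
  have d: "0 < d" "d \<le> 1 / 2" "2 * d \<le> e" using e by (auto simp: d_def)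
  define \<alpha> where "\<alpha> = (SUP x\<in>{0..1}. emeasure lborel (luroth_apart e 0 x))"
  have "\<alpha> \<le> 1"
    unfolding \<alpha>_def
  proof (rule SUP_least)
    fix x
    have "emeasure lborel (luroth_apart e 0 x) \<le> emeasure lborel {0<..1::real}"
      by (intro emeasure_mono luroth_apart_subset) auto
    then show "emeasure lborel (luroth_apart e 0 x) \<le> 1" by simp
  qed
  obtain k where k: "(1 / 2) ^ k < d" using real_arch_pow_inv[of d "1 / 2"] d by auto
  have le: "emeasure lborel (luroth_apart e 0 x) \<le> \<alpha> * ennreal (1 - d)" if x: "x \<in> {0..1}" for x
  proof -
    define l where "l = (if x \<le> 1 / 2 then x else x - d)"
    have G: "\<bar>z - x\<bar> \<le> d" if "z \<in> {l<..l+d}" for z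
      using that by (auto simp: l_def split: if_splits)
    have G01: "{l<..l+d} \<subseteq> {0<..1}" using x d by (auto simp: l_def)
    have "emeasure lborel (luroth_apart e 0 x) \<le>
        emeasure lborel (luroth_apart e 0 ((luroth_map ^^ k) x)) * emeasure lborel ({0<..1} - {l<..l+d})"
    proof (rule emeasure_luroth_preimage_le[where k = k])
      fix y assume y: "y \<in> luroth_apart e 0 x"
      show "(luroth_map ^^ k) y \<in> luroth_apart e 0 ((luroth_map ^^ k) x)"
        using luroth_apart_funpow[OF y] by simp
      fix z assume z: "z \<in> {l<..l+d}"
      have "e \<le> \<bar>x - y\<bar>" using y by (auto simp: luroth_apart_def dest: spec[of _ 0])
      with G[OF z] d have "d \<le> \<bar>y - z\<bar>" by linarith
      with k show "1 / 2 ^ k \<le> \<bar>y - z\<bar>" by (simp add: power_one_over)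
    qed (auto intro: luroth_apart_subset[THEN subsetD])
    also have "\<dots> \<le> \<alpha> * emeasure lborel ({0<..1} - {l<..l+d})"
      unfolding \<alpha>_def by (intro mult_right_mono SUP_upper luroth_map_funpow_unit x) auto
    also have "emeasure lborel ({0<..1} - {l<..l+d}) =
        emeasure lborel {0<..1::real} - emeasure lborel {l<..l+d}"
    proof (rule emeasure_Diff)
      show "emeasure lborel {l<..l + d} \<noteq> \<infinity>" using d by simp
    qed (use G01 in auto)
    also have "\<dots> = ennreal (1 - d)"
      using d by (simp add: ennreal_minus flip: ennreal_1)
    finally show ?thesis .
  qed
  have "\<alpha> \<le> \<alpha> * ennreal (1 - d)"
    unfolding \<alpha>_def by (intro SUP_least) (use le in \<open>auto simp: \<alpha>_def\<close>)
  \<comment> \<open>The supremum is at most 1, hence finite, so the inequality can be read in the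
    reals, where it forces 0.\<close>
  moreover obtain r where r: "\<alpha> = ennreal r" "r \<ge> 0"
    using \<open>\<alpha> \<le> 1\<close> by (cases \<alpha>) (auto simp: top_unique)
  ultimately have "ennreal r \<le> ennreal (r * (1 - d))"
    using d by (simp add: ennreal_mult)
  then have "r \<le> r * (1 - d)"
    using d r by (subst (asm) ennreal_le_iff) auto
  then have "r * d \<le> 0" by (simp add: algebra_simps)
  with r d have "r = 0" by (simp add: mult_le_0_iff)
  with r have "\<alpha> = 0" by simp
  moreover have "emeasure lborel (luroth_apart e 0 x) \<le> \<alpha>"
    unfolding \<alpha>_def using x by (rule SUP_upper)
  ultimately show ?thesis by simp
qed

text \<open>The preimage bound with empty \<open>G\<close> and \<open>k = N\<close> reduces the
  claim to start time 0.\<close>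

lemma emeasure_luroth_apart:
  assumes e: "0 < e" and x: "x \<in> {0..1}"
  shows "emeasure lborel (luroth_apart e N x) = 0"
proof -
  have "emeasure lborel (luroth_apart e N x) \<le>
      emeasure lborel (luroth_apart e 0 ((luroth_map ^^ N) x)) * emeasure lborel ({0<..1} - {} :: real set)"
    using luroth_apart_funpow[of _ e N x N]
    by (intro emeasure_luroth_preimage_le[where k = N] luroth_apart_subset) auto
  also have "\<dots> = 0"
    by (simp only: emeasure_luroth_apart_0[OF e luroth_map_funpow_unit[OF x]] mult_zero_left)
  finally show ?thesis by simp
qed

text \<open>A positive lower limit means that the distances exceed some \<open>1 / Suc m\<close>
  from some time \<open>N\<close> on. The point 0 is listed apart because
  \<open>luroth_apart\<close> lies in (0,1].\<close>

lemma luroth_distal_subset: "luroth_distal x \<subseteq> {0} \<union> (\<Union>m N. luroth_apart (1 / real (Suc m)) N x)"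
proof
  fix y assume y: "y \<in> luroth_distal x"
  let ?f = "\<lambda>n. ereal \<bar>(luroth_map ^^ n) x - (luroth_map ^^ n) y\<bar>"
  have "0 < liminf ?f" using y by (simp add: luroth_distal_def)
  then obtain e' :: ereal where e': "0 < e'" "e' < liminf ?f" using dense by blast
  then have ev: "eventually (\<lambda>n. e' < ?f n) sequentially" by (simp add: less_LiminfD)
  obtain e where e: "e' = ereal e" "0 < e" 
    using e' by (cases e') (auto simp: less_top)
  obtain N where N: "\<And>n. n \<ge> N \<Longrightarrow> e < \<bar>(luroth_map ^^ n) x - (luroth_map ^^ n) y\<bar>"
    using ev e by (auto simp: eventually_sequentially)
  obtain m where m: "1 / real (Suc m) < e" using \<open>0 < e\<close> nat_approx_posE by blast
  have "y \<in> luroth_apart (1 / real (Suc m)) N x" if "y \<noteq> 0"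
    using that y m less_imp_le[OF N] by (force simp: luroth_apart_def luroth_distal_def)
  then show "y \<in> {0} \<union> (\<Union>m N. luroth_apart (1 / real (Suc m)) N x)" by blast
qed

lemma luroth_distal_null:
  assumes "x \<in> {0..1}"
  shows "luroth_distal x \<in> null_sets (lebesgue_on {0..1})"
proof -
  have "luroth_apart (1 / real (Suc m)) N x \<in> null_sets lborel" for m N
    using emeasure_luroth_apart[OF _ assms, of "1 / real (Suc m)" N] by (intro null_setsI) auto
  then have "{0} \<union> (\<Union>m N. luroth_apart (1 / real (Suc m)) N x) \<in> null_sets lborel"
    by (intro null_sets.Un null_sets_UN) auto
  then have "negligible ({0} \<union> (\<Union>m N. luroth_apart (1 / real (Suc m)) N x))"
    unfolding negligible_iff_null_sets by (rule null_sets_completionI)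
  then have "negligible (luroth_distal x)"
    using luroth_distal_subset by (rule negligible_subset)
  moreover have "luroth_distal x \<subseteq> {0..1}" by (auto simp: luroth_distal_def)
  ultimately show ?thesis
    by (simp add: negligible_iff_null_sets null_sets_restrict_space)
qed

section \<open>Hausdorff dimension of subsets of the unit interval\<close>

text \<open>For s > 1, the cover of [0,1] by m intervals of length 1/m has total weight m^(1-s),
  which tends to 0.\<close>

lemma hausdorff_dim_unit_interval_le:
  fixes A :: "real set"
  assumes "A \<subseteq> {0..1}"
  shows "hausdorff_dim A \<le> 1"
proof -
  have zero: "hausdorff_outer_measure s A = 0" if s: "s > 1" for s
  proof -
    have "hausdorff_premeasure s \<delta> A \<le> 0" if \<delta>: "\<delta> > 0" for \<delta>
    proof (rule ennreal_le_epsilon)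
      fix e :: real assume e: "e > 0"
      have "(\<lambda>n. real (Suc n) powr (1 - s)) \<longlonglongrightarrow> 0"
        using s by real_asymp
      then have "\<forall>\<^sub>F n in sequentially. real (Suc n) powr (1 - s) < e"
        using e by (rule order_tendstoD)
      moreover have "(\<lambda>n. 1 / real (Suc n)) \<longlonglongrightarrow> 0" by real_asymp
      then have "\<forall>\<^sub>F n in sequentially. 1 / real (Suc n) < \<delta>"
        using \<delta> by (rule order_tendstoD)
      ultimately have "\<forall>\<^sub>F n in sequentially. real (Suc n) powr (1 - s) < e \<and> 1 / real (Suc n) < \<delta>"
        by (rule eventually_conj)
      then obtain n where n: "real (Suc n) powr (1 - s) < e" "1 / real (Suc n) < \<delta>"
        by (auto simp: eventually_sequentially)
      define m where "m = Suc n"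
      define U where "U i = (if i < m then {real i / m .. (real i + 1) / m} else {})" for i
      have m: "m > 0" by (simp add: m_def)
      have diam: "diameter (U i) = (if i < m then 1 / m else 0)" for i
        using m divide_right_mono[of "real i" "real i + 1" "real m"]
        by (simp add: U_def diameter_closed_interval diff_divide_distrib[symmetric])
      have "A \<subseteq> (\<Union>i. U i)"
      proof
        fix y assume "y \<in> A"
        then have y: "0 \<le> y" "y \<le> 1" using assms by auto
        show "y \<in> (\<Union>i. U i)"
        \<comment> \<open>At \<open>y = 1\<close> the floor below would give the index
          \<open>m\<close>, one too many; the last interval contains this point.\<close>
        proof (cases "y = 1")
          case True
          then have "y \<in> U (m - 1)" using m by (auto simp: U_def of_nat_diff field_simps)
          then show ?thesis by blast
        next
          case False
          define i where "i = nat \<lfloor>y * m\<rfloor>"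
          have i: "real i \<le> y * m" "y * m < real i + 1"
            using y by (auto simp: i_def)
          have "y * m < m" using y False m by simp
          with i have "i < m" by linarith
          with i m have "y \<in> U i" by (auto simp: U_def field_simps)
          then show ?thesis by blast
        qed
      qed
      moreover have "bounded (U i) \<and> diameter (U i) \<le> \<delta>" for i
      proof
        show "bounded (U i)" by (simp add: U_def)
        show "diameter (U i) \<le> \<delta>" using n \<delta> by (auto simp: diam m_def)
      qed
      ultimately have "hausdorff_premeasure s \<delta> A \<le> (\<Sum>i. diam_weight s (U i))"
        unfolding hausdorff_premeasure_def
        by (intro Inf_lower CollectI exI[of _ U] conjI allI) simp_all
      also have "\<dots> = (\<Sum>i<m. diam_weight s (U i))"
        by (rule suminf_finite) (auto simp: diam_weight_def U_def)
      also have "\<dots> \<le> (\<Sum>i<m. ennreal ((1 / m) powr s))"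
        by (intro sum_mono) (use s in \<open>simp add: diam_weight_def diam\<close>)
      also have "\<dots> = ennreal (m * (1 / m) powr s)"
        by (subst sum_ennreal) auto
      also have "m * (1 / m) powr s = real m powr (1 - s)"
        using m by (simp add: powr_diff powr_divide)
      also have "ennreal \<dots> \<le> 0 + ennreal e"
        using n by (simp add: m_def ennreal_leI)
      finally show "hausdorff_premeasure s \<delta> A \<le> 0 + ennreal e" .
    qed
    then show ?thesis
      unfolding hausdorff_outer_measure_def by (auto intro!: antisym SUP_least)
  qed
  show ?thesis
  proof (rule ennreal_le_epsilon)
    fix e :: real assume e: "e > 0"
    have "hausdorff_dim A \<le> ennreal (1 + e)"
      unfolding hausdorff_dim_def using zero[of "1 + e"] e
      by (intro Inf_lower CollectI exI[of _ "1 + e"]) simp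
    then show "hausdorff_dim A \<le> 1 + ennreal e" using e by (simp add: ennreal_plus)
  qed
qed

lemma hausdorff_outer_measure_0_pos:
  assumes "A \<noteq> {}"
  shows "hausdorff_outer_measure 0 A \<noteq> 0"
proof -
  have "1 \<le> hausdorff_premeasure 0 1 A"
    unfolding hausdorff_premeasure_def
  proof (rule Inf_greatest, safe)
    fix U :: "nat \<Rightarrow> 'a set" assume "A \<subseteq> (\<Union>i. U i)"
    then obtain i where "U i \<noteq> {}" using assms by blast
    then have "1 \<le> (\<Sum>j\<in>{i}. diam_weight 0 (U j))" by (simp add: diam_weight_def)
    also have "\<dots> \<le> (\<Sum>j. diam_weight 0 (U j))" by (rule sum_le_suminf) auto
    finally show "1 \<le> (\<Sum>j. diam_weight 0 (U j))" .
  qed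
  also have "\<dots> \<le> hausdorff_outer_measure 0 A"
    unfolding hausdorff_outer_measure_def by (rule SUP_upper) simp
  finally show ?thesis by auto
qed

text \<open>A mass distribution argument: a cover of \<open>A\<close> pulls back along
  \<open>g\<close> to a cover of [0,1) by sets of diameter at most
  \<open>diameter (U i) powr s / C\<close>. These lengths sum to at least 1, so the weights sum to
  at least \<open>C\<close>.\<close>

lemma hausdorff_outer_measure_pos:
  fixes g :: "real \<Rightarrow> 'a :: metric_space"
  assumes s: "s > 0" and C: "C > 0" and gA: "\<And>t. t \<in> {0..<1} \<Longrightarrow> g t \<in> A"
    and expand: "\<And>t t'. t \<in> {0..<1} \<Longrightarrow> t' \<in> {0..<1} \<Longrightarrow> C * \<bar>t - t'\<bar> \<le> dist (g t) (g t') powr s"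
  shows "hausdorff_outer_measure s A \<noteq> 0"
proof -
  have "ennreal C \<le> hausdorff_premeasure s 1 A"
    unfolding hausdorff_premeasure_def
  proof (rule Inf_greatest, safe)
    fix U :: "nat \<Rightarrow> 'a set"
    assume cov: "A \<subseteq> (\<Union>i. U i)" and bd: "\<forall>i. bounded (U i) \<and> diameter (U i) \<le> 1"
    define V where "V i = {t \<in> {0..<1}. g t \<in> U i}" for i
    define r where "r i = diameter (U i) powr s / C" for i
    \<comment> \<open>\<open>V i\<close> may fail to be measurable, so it is enclosed in a closed
      interval of length \<open>r i\<close>.\<close>
    define J where "J i = (if V i = {} then {} else {Inf (V i) .. Inf (V i) + r i})" for i
    have "V i \<subseteq> J i" for i
    proof
      fix t assume t: "t \<in> V i"
      have bb: "bdd_below (V i)" by (auto simp: V_def bdd_below_def intro!: exI[of _ 0])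
      have "t - r i \<le> t'" if t': "t' \<in> V i" for t'
      proof -
        have "C * \<bar>t - t'\<bar> \<le> dist (g t) (g t') powr s"
          using t t' by (intro expand) (auto simp: V_def)
        also have "\<dots> \<le> diameter (U i) powr s"
          using t t' bd s by (intro powr_mono2 diameter_bounded_bound) (auto simp: V_def)
        finally have "\<bar>t - t'\<bar> \<le> r i" using C by (simp add: r_def field_simps)
        then show ?thesis by linarith
      qed
      then have "t - r i \<le> Inf (V i)" using t by (intro cInf_greatest) auto
      moreover have "Inf (V i) \<le> t" using t bb by (rule cInf_lower)
      ultimately show "t \<in> J i" using t by (auto simp: J_def)
    qed
    then have "(\<Union>i. V i) \<subseteq> (\<Union>i. J i)" by (intro UN_mono) auto
    moreover have "{0..<1} \<subseteq> (\<Union>i. V i)"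
    proof
      fix t :: real assume t: "t \<in> {0..<1}"
      then obtain i where "g t \<in> U i" using gA[OF t] cov by blast
      with t have "t \<in> V i" by (simp add: V_def)
      then show "t \<in> (\<Union>i. V i)" by blast
    qed
    ultimately have "{0..<1} \<subseteq> (\<Union>i. J i)" by (rule order_trans[rotated])
    then have "emeasure lborel {0..<1::real} \<le> emeasure lborel (\<Union>i. J i)"
      by (intro emeasure_mono) (auto simp: J_def)
    also have "\<dots> \<le> (\<Sum>i. emeasure lborel (J i))"
      by (intro emeasure_subadditive_countably) (auto simp: J_def)
    finally have 1: "1 \<le> (\<Sum>i. emeasure lborel (J i))" by simp
    have "ennreal C * 1 \<le> ennreal C * (\<Sum>i. emeasure lborel (J i))"
      using 1 by (rule mult_left_mono) simp
    also have "\<dots> = (\<Sum>i. ennreal C * emeasure lborel (J i))"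
      by (rule ennreal_suminf_cmult[symmetric])
    also have "\<dots> \<le> (\<Sum>i. diam_weight s (U i))"
    proof (intro suminf_le)
      fix i
      show "ennreal C * emeasure lborel (J i) \<le> diam_weight s (U i)"
      proof (cases "V i = {}")
        case False
        then have "U i \<noteq> {}" by (auto simp: V_def)
        moreover have "ennreal C * emeasure lborel (J i) = ennreal (C * r i)"
        proof -
          have "0 \<le> r i" using C by (simp add: r_def)
          then show ?thesis using C False by (simp add: J_def ennreal_mult)
        qed
        moreover have "C * r i = diameter (U i) powr s" using C by (simp add: r_def)
        ultimately show ?thesis using s by (simp add: diam_weight_def)
      qed (simp add: J_def)
    qed auto
    finally show "ennreal C \<le> (\<Sum>i. diam_weight s (U i))" by simp
  qed
  also have "\<dots> \<le> hausdorff_outer_measure s A"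
    unfolding hausdorff_outer_measure_def by (rule SUP_upper) simp
  finally show ?thesis using C by (auto simp: ennreal_eq_0_iff)
qed

section \<open>Points with prescribed digits\<close>

text \<open>The Lueroth series: the point with the digit sequence \<open>d\<close>.\<close>

definition luroth_val :: "(nat \<Rightarrow> nat) \<Rightarrow> real" where
  "luroth_val d = (\<Sum>k. 1 / real (d k) / (\<Prod>i<k. luroth_slope (d i)))"

text \<open>Digits and slopes are at least 2, so the term of index k is at most (1/2)^(k+1); this
  gives convergence and the bound 1. Splitting off the first term gives the recursion.\<close>

lemma luroth_val_facts:
  assumes d: "\<And>k. d k \<ge> 2"
  shows luroth_val_rec: "luroth_val d = luroth_inv (d 0) (luroth_val (\<lambda>k. d (Suc k)))"
    and luroth_val_bounds: "luroth_val d \<in> {0<..1}"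
proof -
  let ?f = "\<lambda>d k. 1 / real (d k) / (\<Prod>i<k. luroth_slope (d i))"
  have pos: "0 < ?f d k" if "\<And>k. d k \<ge> 2" for d :: "nat \<Rightarrow> nat" and k
    using that luroth_slope_pos
    by (intro divide_pos_pos prod_pos) (auto intro: less_le_trans[of 0 2])
  have le: "?f d k \<le> (1 / 2) * (1 / 2) ^ k" if d: "\<And>k. d k \<ge> 2" for d :: "nat \<Rightarrow> nat" and k
  proof -
    have "(\<Prod>i<k. 2) \<le> (\<Prod>i<k. luroth_slope (d i))"
      using d luroth_slope_ge2 by (intro prod_mono) auto
    then have "2 ^ k \<le> (\<Prod>i<k. luroth_slope (d i))" by simp
    moreover have "2 \<le> real (d k)" using d[of k] by simp
    ultimately have "?f d k \<le> 1 / 2 / 2 ^ k" by (intro frac_le) auto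
    then show ?thesis by (simp add: power_one_over)
  qed
  have geo: "(\<lambda>k. (1 / 2) * (1 / 2) ^ k :: real) sums 1"
    using sums_mult[OF geometric_sums[of "1 / 2 :: real"], of "1 / 2"] by simp
  have sm: "summable (?f d)" if d: "\<And>k. d k \<ge> 2" for d :: "nat \<Rightarrow> nat"
  proof (rule summable_comparison_test'[OF sums_summable[OF geo]])
    fix k :: nat
    show "norm (?f d k) \<le> (1 / 2) * (1 / 2) ^ k"
      using le[of d k] pos[of d k] d by (simp only: real_norm_def abs_of_pos)
  qed
  have "luroth_val d \<le> (\<Sum>k. (1 / 2) * (1 / 2) ^ k)"
    unfolding luroth_val_def using le d by (intro suminf_le sm sums_summable[OF geo]) auto
  also have "\<dots> = 1" using geo by (rule sums_unique[symmetric])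
  finally have "luroth_val d \<le> 1" .
  moreover have "luroth_val d > 0"
    unfolding luroth_val_def using pos d by (intro suminf_pos sm) auto
  ultimately show "luroth_val d \<in> {0<..1}" by simp
  let ?d = "\<lambda>k. d (Suc k)"
  have "luroth_val d = ?f d 0 + (\<Sum>k. ?f d (Suc k))"
    unfolding luroth_val_def using suminf_split_head[OF sm[of d]] d by simp
  also have "(\<lambda>k. ?f d (Suc k)) = (\<lambda>k. ?f ?d k / luroth_slope (d 0))"
    by (simp add: prod.lessThan_Suc_shift mult_ac del: prod.lessThan_Suc)
  also have "(\<Sum>k. ?f ?d k / luroth_slope (d 0)) = luroth_val ?d / luroth_slope (d 0)"
    unfolding luroth_val_def using sm[of ?d] d by (intro suminf_divide) auto
  finally show "luroth_val d = luroth_inv (d 0) (luroth_val ?d)"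
    by (simp add: luroth_inv_def)
qed

lemma luroth_map_funpow_val:
  assumes "\<And>k. d k \<ge> 2"
  shows "(luroth_map ^^ n) (luroth_val d) = luroth_val (\<lambda>k. d (n + k))"
  using assms
proof (induction n arbitrary: d)
  case (Suc n)
  have "luroth_map (luroth_val d) = luroth_val (\<lambda>k. d (Suc k))"
    using Suc.prems luroth_val_bounds[of "\<lambda>k. d (Suc k)"]
    by (subst luroth_val_rec) (auto intro: luroth_map_inv)
  then show ?case
    using Suc.IH[of "\<lambda>k. d (Suc k)"] Suc.prems
    by (simp add: funpow_Suc_right del: funpow.simps)
qed simp

text \<open>A first digit of at least 3 puts the point into (0,1/2], and each digit 2 in front
  halves the distance to 1.\<close>

lemma luroth_val_less_1:
  assumes "\<And>k. d k \<ge> 2" "d i \<noteq> 2"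
  shows "luroth_val d \<le> 1 - 1 / 2 ^ Suc i"
  using assms
proof (induction i arbitrary: d)
  case 0
  then have "d 0 \<ge> 3" using 0(1)[of 0] by linarith
  then have "1 / (real (d 0) - 1) \<le> 1 / 2" by (intro divide_left_mono) auto
  moreover have "luroth_val d \<le> 1 / (real (d 0) - 1)"
    using 0(1) by (subst luroth_val_rec) (auto intro!: luroth_inv_bounds luroth_val_bounds[unfolded greaterThanAtMost_iff])
  ultimately show ?case by simp
next
  case (Suc i)
  let ?z = "luroth_val (\<lambda>k. d (Suc k))"
  have z: "?z \<le> 1 - 1 / 2 ^ Suc i" "?z \<in> {0<..1}"
    using Suc.IH[of "\<lambda>k. d (Suc k)"] Suc.prems luroth_val_bounds[of "\<lambda>k. d (Suc k)"] by auto
  show ?case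
  proof (cases "d 0 = 2")
    case True
    have "luroth_val d = 1 / 2 + ?z / 2"
      using Suc.prems True by (subst luroth_val_rec) (auto simp: luroth_inv_def luroth_slope_def)
    moreover have "?z / 2 \<le> (1 - 1 / 2 ^ Suc i) / 2" using z by (intro divide_right_mono) auto
    moreover have "(1 - 1 / 2 ^ Suc i) / 2 = 1 / 2 - (1 :: real) / 2 ^ Suc (Suc i)"
      by (simp add: diff_divide_distrib)
    ultimately show ?thesis by simp
  next
    case False
    then have "d 0 \<ge> 3" using Suc.prems(1)[of 0] by linarith
    then have "1 / (real (d 0) - 1) \<le> 1 / 2" by (intro divide_left_mono) auto
    moreover have "luroth_val d \<le> 1 / (real (d 0) - 1)"
      using Suc.prems(1) z by (subst luroth_val_rec) (auto intro!: luroth_inv_bounds)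
    moreover have "(1::real) / 2 ^ Suc (Suc i) \<le> 1 / 2 ^ 1"
      by (intro divide_left_mono power_increasing) auto
    ultimately show ?thesis unfolding power_one_right by linarith
  qed
qed

text \<open>The inverse branches of a common prefix compose to an affine map, which scales
  differences by the length of the cylinder.\<close>

lemma luroth_val_diff:
  assumes "\<And>k. d k \<ge> 2" "\<And>k. d' k \<ge> 2" "\<And>i. i < n \<Longrightarrow> d i = d' i"
  shows "luroth_val d - luroth_val d' =
    (luroth_val (\<lambda>k. d (n + k)) - luroth_val (\<lambda>k. d' (n + k))) / (\<Prod>i<n. luroth_slope (d i))"
  using assms
proof (induction n arbitrary: d d')
  case (Suc n)
  have "luroth_val d - luroth_val d' =
      (luroth_val (\<lambda>k. d (Suc k)) - luroth_val (\<lambda>k. d' (Suc k))) / luroth_slope (d 0)"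
    using Suc.prems(3)[of 0] luroth_val_rec[of d] luroth_val_rec[of d'] Suc.prems(1,2)
    by (simp add: luroth_inv_diff)
  also have "luroth_val (\<lambda>k. d (Suc k)) - luroth_val (\<lambda>k. d' (Suc k)) =
     (luroth_val (\<lambda>k. d (Suc n + k)) - luroth_val (\<lambda>k. d' (Suc n + k))) / (\<Prod>i<n. luroth_slope (d (Suc i)))"
    using Suc.IH[of "\<lambda>k. d (Suc k)" "\<lambda>k. d' (Suc k)"] Suc.prems by simp
  finally show ?case
    by (simp add: prod.lessThan_Suc_shift mult_ac del: prod.lessThan_Suc)
qed simp

text \<open>The orbit of \<open>luroth_val d\<close> stays in the middle of the branch intervals, so an orbit that is
  once in a different branch interval cannot have been close to it shortly before.\<close>
lemma luroth_val_separation: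
  assumes d: "\<And>k. 2 \<le> d k \<and> d k \<le> M" and c: "0 < c"
    and mid: "\<And>k. luroth_val (\<lambda>i. d (k + i)) \<in> {c..1 - c}"
    and x: "(luroth_map ^^ k) x \<notin> luroth_inv (d k) ` {0<..1}"
  shows "c / luroth_slope M ^ Suc k \<le> \<bar>x - luroth_val d\<bar>"
proof -
  have M: "luroth_slope M \<ge> 2" using d[of 0] by (intro luroth_slope_ge2) linarith
  \<comment> \<open>A point outside the branch interval of \<open>d 0\<close> is separated from
    \<open>luroth_val d\<close> by an endpoint of it, and \<open>luroth_val d\<close> is at least
    \<open>c\<close> times the interval length away from both endpoints.\<close>
  have base: "c / luroth_slope M ^ Suc k \<le> \<bar>x - luroth_val d\<bar>"
    if d: "\<And>k. 2 \<le> d k \<and> d k \<le> M" and z: "luroth_val (\<lambda>i. d (Suc i)) \<in> {c..1 - c}"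
      and x: "x \<notin> luroth_inv (d 0) ` {0<..1}" for x k and d :: "nat \<Rightarrow> nat"
  proof -
    let ?z = "luroth_val (\<lambda>i. d (Suc i))" and ?q = "luroth_slope (d 0)"
    have d0: "2 \<le> d 0" "?q > 0" using d luroth_slope_pos by auto
    have val: "luroth_val d = 1 / real (d 0) + ?z / ?q"
      using d by (subst luroth_val_rec) (auto simp: luroth_inv_def)
    have "x \<le> 1 / real (d 0) \<or> x > 1 / real (d 0) + 1 / ?q"
      using x luroth_inv_image[OF d0(1)] luroth_inv_1[OF d0(1)] by (auto simp: luroth_inv_def)
    moreover have "c / ?q \<le> ?z / ?q" "?z / ?q \<le> (1 - c) / ?q"
      using z d0 by (auto intro: divide_right_mono)
    ultimately have "c / ?q \<le> \<bar>x - luroth_val d\<bar>"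
      unfolding val diff_divide_distrib by linarith
    moreover have "?q \<le> luroth_slope M ^ Suc k"
    proof -
      have "?q \<le> luroth_slope M" using d by (intro luroth_slope_mono) auto
      also have "\<dots> \<le> luroth_slope M ^ Suc k" using M self_le_power[of "luroth_slope M" "Suc k"] by simp
      finally show ?thesis .
    qed
    then have "c / luroth_slope M ^ Suc k \<le> c / ?q"
      using c d0 M by (intro divide_left_mono mult_pos_pos) auto
    ultimately show ?thesis by linarith
  qed
  show ?thesis
    using d mid x
  proof (induction k arbitrary: x d)
    case 0
    then show ?case using base[of d x 0] by (metis funpow_0 plus_1_eq_Suc)
  next
    case (Suc k)
    have z: "luroth_val (\<lambda>i. d (Suc i)) \<in> {c..1 - c}" using Suc.prems(2)[of 1] by simp
    show ?case
    proof (cases "x \<in> luroth_inv (d 0) ` {0<..1}")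
      case False
      then show ?thesis by (rule base[OF Suc.prems(1) z])
    next
      case True
      then obtain u where u: "u \<in> {0<..1}" "x = luroth_inv (d 0) u" by auto
      have d0: "2 \<le> d 0" "luroth_slope (d 0) > 0" "luroth_slope (d 0) \<le> luroth_slope M"
        using Suc.prems(1) luroth_slope_pos luroth_slope_mono by auto
      have "luroth_map x = u" using u d0 by (simp add: luroth_map_inv)
      \<comment> \<open>Both points lie in the branch of \<open>d 0\<close>, whose inverse shrinks
        distances by at most the factor \<open>luroth_slope M\<close>.\<close>
      then have "c / luroth_slope M ^ Suc k \<le> \<bar>u - luroth_val (\<lambda>i. d (Suc i))\<bar>"
        using Suc.prems(1,3) Suc.prems(2)[of "Suc _"]
        by (intro Suc.IH) (auto simp: funpow_Suc_right simp del: funpow.simps)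
      then have "c / luroth_slope M ^ Suc k / luroth_slope M \<le> \<bar>u - luroth_val (\<lambda>i. d (Suc i))\<bar> / luroth_slope (d 0)"
        using d0 c M by (intro frac_le) auto
      also have "\<dots> = \<bar>x - luroth_val d\<bar>"
        using Suc.prems(1) d0 by (subst luroth_val_rec) (auto simp: u luroth_inv_diff)
      finally show ?thesis by (simp add: mult_ac)
    qed
  qed
qed

section \<open>Many words with the same cylinder length\<close>

text \<open>With exponent 1 the sum telescopes to 1 - 1/M. Lowering the exponent to \<open>s\<close>
  raises the term of digit 2 by the fixed amount \<delta>, which outweighs 1/M for large
  \<open>M\<close>. The bound 4 makes room for the digits 3 and 4 inserted later.\<close>

lemma luroth_slope_sum_gt_1:
  assumes s: "0 < s" "s < 1"
  obtains M where "M \<ge> 4" "(\<Sum>a\<in>{2..M}. 1 / luroth_slope a powr s) > 1"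
proof -
  define \<delta> where "\<delta> = (1 / 2) powr s - (1 / 2 :: real)"
  have "(1 / 2 :: real) powr 1 < (1 / 2) powr s"
    using s by (intro powr_less_mono') auto
  then have \<delta>: "\<delta> > 0" by (simp add: \<delta>_def)
  obtain M0 where M0: "1 / real (Suc M0) < \<delta>" using \<delta> nat_approx_posE by blast
  define M where "M = max 4 (Suc M0)"
  have "1 / real M \<le> 1 / real (Suc M0)" by (intro divide_left_mono) (auto simp: M_def)
  with M0 have M: "1 / real M < \<delta>" "M \<ge> 4" by (auto simp: M_def)
  have tel: "(\<Sum>a\<in>{2..M}. 1 / luroth_slope a) = 1 - 1 / M" if "M \<ge> 2" for M
    using that
  proof (induction M rule: dec_induct)
    case (step n)
    have "1 / luroth_slope (Suc n) = 1 / real n - 1 / real (Suc n)"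
      using step by (simp add: luroth_slope_def field_simps)
    with step show ?case by simp
  qed (simp add: luroth_slope_def)
  have "1 < 1 - 1 / M + \<delta>" using M by simp
  also have "\<dots> = (\<Sum>a\<in>{2..M}. 1 / luroth_slope a) + \<delta>" using tel M by simp
  also have "(\<Sum>a\<in>{2..M}. 1 / luroth_slope a) = 1 / 2 + (\<Sum>a\<in>{3..M}. 1 / luroth_slope a)"
    using M by (subst sum.atLeast_Suc_atMost) (auto simp: luroth_slope_def numeral_3_eq_3 numeral_2_eq_2)
  also have "1 / 2 + (\<Sum>a\<in>{3..M}. 1 / luroth_slope a) + \<delta> =
      1 / luroth_slope 2 powr s + (\<Sum>a\<in>{3..M}. 1 / luroth_slope a)"
    by (simp add: \<delta>_def luroth_slope_def powr_divide)
  also have "\<dots> \<le> 1 / luroth_slope 2 powr s + (\<Sum>a\<in>{3..M}. 1 / luroth_slope a powr s)"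
  proof (intro add_left_mono sum_mono divide_left_mono)
    fix a assume "a \<in> {3..M}"
    then have a: "luroth_slope a \<ge> 2" by (intro luroth_slope_ge2) auto
    then show "luroth_slope a powr s \<le> luroth_slope a"
      using s powr_mono[of s 1 "luroth_slope a"] by simp
    show "0 < luroth_slope a * luroth_slope a powr s" using a by simp
  qed simp
  also have "\<dots> = (\<Sum>a\<in>{2..M}. 1 / luroth_slope a powr s)"
    using M by (subst (2) sum.atLeast_Suc_atMost) (auto simp: numeral_3_eq_3 numeral_2_eq_2)
  finally show ?thesis using that M by blast
qed

text \<open>Words with the same letter counts have cylinders of the same length, and there are only
  polynomially many letter counts in the word length.\<close>
lemma luroth_words:
  assumes s: "0 < s" "s < 1"
  obtains M n :: nat and R W where "M \<ge> 4" "R \<ge> 1" "finite W" "W \<subseteq> ({..<n} \<rightarrow>\<^sub>E {2..M})"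
    "\<And>w. w \<in> W \<Longrightarrow> (\<Prod>i<n. luroth_slope (w i)) = R" "B * R powr s \<le> real (card W)"
proof -
  obtain M where M: "M \<ge> 4" and \<theta>1: "(\<Sum>a\<in>{2..M}. 1 / luroth_slope a powr s) > 1"
    using luroth_slope_sum_gt_1[OF s] .
  define \<theta> where "\<theta> = (\<Sum>a\<in>{2..M}. 1 / luroth_slope a powr s)"
  have \<theta>: "\<theta> > 1" using \<theta>1 by (simp add: \<theta>_def)
  \<comment> \<open>The words of length \<open>n\<close> have total weight \<theta>^n, while at most
    (n+1)^(M-1) letter counts occur.\<close>
  have "(\<lambda>n. B * real (Suc n) ^ (M - 1) / \<theta> ^ n) \<longlonglongrightarrow> 0"
    using \<theta> by real_asymp
  then have "\<forall>\<^sub>F n in sequentially. B * real (Suc n) ^ (M - 1) / \<theta> ^ n < 1"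
    by (rule order_tendstoD) simp
  then obtain n where "B * real (Suc n) ^ (M - 1) / \<theta> ^ n < 1"
    by (auto simp: eventually_sequentially)
  then have n: "B * real (Suc n) ^ (M - 1) < \<theta> ^ n" using \<theta> by (simp add: field_simps)
  define V where "V = ({..<n} \<rightarrow>\<^sub>E {2..M})"
  define h where "h w = (\<lambda>a\<in>{2..M}. card {i\<in>{..<n}. w i = a})" for w :: "nat \<Rightarrow> nat"
  define P where "P w = (\<Prod>i<n. luroth_slope (w i))" for w
  have finV: "finite V" by (simp add: V_def finite_PiE)
  have P1: "P w \<ge> 1" if "w \<in> V" for w
    unfolding P_def using that
    by (intro prod_ge_1 order_trans[OF _ luroth_slope_ge2]) (auto simp: V_def PiE_def Pi_def)
  have Ph: "P w = (\<Prod>a\<in>{2..M}. luroth_slope a ^ h w a)" if w: "w \<in> V" for w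
  proof -
    have "P w = (\<Prod>a\<in>{2..M}. \<Prod>i\<in>{i\<in>{..<n}. w i = a}. luroth_slope (w i))"
      unfolding P_def using w by (intro prod.group[symmetric]) (auto simp: V_def)
    also have "\<dots> = (\<Prod>a\<in>{2..M}. luroth_slope a ^ h w a)"
      by (intro prod.cong) (auto simp: h_def)
    finally show ?thesis .
  qed
  have "h ` V \<subseteq> ({2..M} \<rightarrow>\<^sub>E {0..n})"
  proof (intro image_subsetI PiE_I)
    fix w a
    show "h w a \<in> {0..n}" if "a \<in> {2..M}"
      using that card_mono[of "{..<n}" "{i\<in>{..<n}. w i = a}"] by (auto simp: h_def)
  qed (auto simp: h_def)
  then have "card (h ` V) \<le> card ({2..M} \<rightarrow>\<^sub>E {0..n})"
    by (intro card_mono finite_PiE) auto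
  also have "\<dots> = Suc n ^ (M - 1)" by (simp add: card_PiE)
  finally have card_h: "card (h ` V) \<le> Suc n ^ (M - 1)" .
  have sum_V: "(\<Sum>w\<in>V. 1 / P w powr s) = \<theta> ^ n"
  proof -
    have "\<theta> ^ n = (\<Prod>i<n. \<Sum>a\<in>{2..M}. 1 / luroth_slope a powr s)" by (simp add: \<theta>_def)
    also have "\<dots> = (\<Sum>w\<in>V. \<Prod>i<n. 1 / luroth_slope (w i) powr s)"
      unfolding V_def by (rule prod_sum_PiE) auto
    also have "\<dots> = (\<Sum>w\<in>V. 1 / P w powr s)"
    proof (rule sum.cong)
      fix w assume "w \<in> V"
      have "P w powr s = (\<Prod>i<n. luroth_slope (w i) powr s)"
        unfolding P_def by (rule prod_powr_distrib)
      then show "(\<Prod>i<n. 1 / luroth_slope (w i) powr s) = 1 / P w powr s"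
        by (simp add: prod_dividef)
    qed simp
    finally show ?thesis by simp
  qed
  \<comment> \<open>Pigeonhole: otherwise the total weight would be at most \<open>B\<close> times
    the number of letter counts.\<close>
  have "\<exists>v\<in>h ` V. B \<le> (\<Sum>w | w \<in> V \<and> h w = v. 1 / P w powr s)"
  proof (rule ccontr)
    assume "\<not> ?thesis"
    then have less: "(\<Sum>w | w \<in> V \<and> h w = v. 1 / P w powr s) \<le> B" if "v \<in> h ` V" for v
      using that by force
    \<comment> \<open>The constant word shows that \<open>V\<close> is nonempty, so \<open>B\<close>
      bounds some nonnegative sum.\<close>
    have "(\<lambda>i\<in>{..<n}. 2) \<in> V" using M by (auto simp: V_def)
    then have "0 \<le> B"
      using less[of "h (\<lambda>i\<in>{..<n}. 2)"] sum_nonneg[of _ "\<lambda>w. 1 / P w powr s"] by (force intro: order_trans)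
    have "\<theta> ^ n = (\<Sum>v\<in>h ` V. \<Sum>w | w \<in> V \<and> h w = v. 1 / P w powr s)"
      unfolding sum_V[symmetric] by (rule sum.image_gen[OF finV])
    also have "\<dots> \<le> (\<Sum>v\<in>h ` V. B)" using less by (rule sum_mono)
    also have "\<dots> = B * real (card (h ` V))" by simp
    also have "\<dots> \<le> B * real (Suc n ^ (M - 1))"
      using card_h \<open>0 \<le> B\<close> by (intro mult_left_mono) (auto simp only: of_nat_le_iff)
    finally show False using n by simp
  qed
  then obtain w0 where w0: "w0 \<in> V" and B: "B \<le> (\<Sum>w | w \<in> V \<and> h w = h w0. 1 / P w powr s)" by blast
  define W where "W = {w \<in> V. h w = h w0}"
  have PW: "P w = P w0" if "w \<in> W" for w using that w0 by (simp add: W_def Ph)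
  have "B \<le> (\<Sum>w\<in>W. 1 / P w0 powr s)" using B PW by (simp add: W_def)
  then have "B * P w0 powr s \<le> card W"
    using P1[OF w0] by (simp add: field_simps)
  then show ?thesis
    using that[of M "P w0" W n] M P1[OF w0] finV PW by (auto simp: W_def V_def P_def)
qed

section \<open>Coding a large subset of the distal set\<close>

definition base_digit :: "nat \<Rightarrow> real \<Rightarrow> nat \<Rightarrow> nat" where
  "base_digit N t j = nat \<lfloor>t * real N ^ Suc j\<rfloor> mod N"

text \<open>By induction the first \<open>j\<close> digits determine the floor of
  \<open>t * N ^ j\<close>: division by \<open>N\<close> recovers the previous floor, and the
  remainder is the next digit.\<close>

lemma base_digit_close:
  assumes "t \<in> {0..<1}" "t' \<in> {0..<1}" "N > 0" "\<And>i. i < j \<Longrightarrow> base_digit N t i = base_digit N t' i"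
  shows "\<bar>t - t'\<bar> \<le> 1 / real N ^ j"
proof -
  have step: "\<lfloor>t * real N ^ Suc i\<rfloor> div int N = \<lfloor>t * real N ^ i\<rfloor>" for t i
    using floor_divide_real_eq_div[of "int N" "t * real N ^ Suc i"] assms(3) by simp
  have "\<lfloor>t * real N ^ j\<rfloor> = \<lfloor>t' * real N ^ j\<rfloor>"
    using assms(4)
  proof (induction j)
    case 0
    have "\<lfloor>t\<rfloor> = 0" "\<lfloor>t'\<rfloor> = 0" using assms(1,2) by (simp_all add: floor_eq_iff)
    then show ?case by simp
  next
    case (Suc j)
    let ?m = "\<lfloor>t * real N ^ Suc j\<rfloor>" and ?m' = "\<lfloor>t' * real N ^ Suc j\<rfloor>"
    have pos: "?m \<ge> 0" "?m' \<ge> 0" using assms(1,2) by auto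
    have "int (base_digit N t j) = ?m mod int N" "int (base_digit N t' j) = ?m' mod int N"
      unfolding base_digit_def using pos by (simp_all add: zmod_int)
    then have "?m mod int N = ?m' mod int N" using Suc.prems[of j] by simp
    moreover have "?m div int N = ?m' div int N"
      using Suc.IH Suc.prems unfolding step by simp
    ultimately show ?case by (metis div_mult_mod_eq)
  qed
  then have "\<bar>t * real N ^ j - t' * real N ^ j\<bar> \<le> 1" by linarith
  then have "\<bar>t - t'\<bar> * real N ^ j \<le> 1"
    by (simp add: abs_mult flip: left_diff_distrib)
  then show ?thesis using assms(3) by (simp add: field_simps)
qed

lemma base_digit_differ:
  assumes "t \<in> {0..<1}" "t' \<in> {0..<1}" "t \<noteq> t'" "N \<ge> 2"
  obtains j where "base_digit N t j \<noteq> base_digit N t' j"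
    "\<And>i. i < j \<Longrightarrow> base_digit N t i = base_digit N t' i"
proof -
  have "\<exists>j. base_digit N t j \<noteq> base_digit N t' j"
  proof (rule ccontr)
    assume "\<not> ?thesis"
    then have "\<bar>t - t'\<bar> \<le> (1 / real N) ^ j" for j
      using base_digit_close[of t t' N j] assms by (simp add: power_one_over)
    moreover obtain j where "(1 / real N) ^ j < \<bar>t - t'\<bar>"
      using real_arch_pow_inv[of "\<bar>t - t'\<bar>" "1 / real N"] assms by auto
    ultimately show False by (meson not_le)
  qed
  then show ?thesis
    unfolding exists_least_iff[of "\<lambda>j. base_digit N t j \<noteq> base_digit N t' j"] using that by blast
qed

lemma luroth_distalI:
  assumes "y \<in> {0..1}" "0 < c" "\<And>n. c \<le> \<bar>(luroth_map ^^ n) x - (luroth_map ^^ n) y\<bar>"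
  shows "y \<in> luroth_distal x"
proof -
  have "ereal c \<le> liminf (\<lambda>n. ereal \<bar>(luroth_map ^^ n) x - (luroth_map ^^ n) y\<bar>)"
    using assms(3) by (intro Liminf_bounded) auto
  with assms(2) have "0 < liminf (\<lambda>n. ereal \<bar>(luroth_map ^^ n) x - (luroth_map ^^ n) y\<bar>)"
    by (meson ereal_less(2) less_le_trans)
  moreover have "y \<noteq> x" using assms(3)[of 0] assms(2) by auto
  ultimately show ?thesis using assms(1) by (simp add: luroth_distal_def)
qed

text \<open>Digits come in blocks of length \<open>n + 1\<close>: a word of \<open>W\<close> selected by a base \<open>N\<close> digit of
  \<open>t\<close>, where \<open>N = card W\<close>, followed by a digit 3 or 4 that keeps the orbit out of the branch
  interval of the orbit of \<open>x\<close>. The extra digit multiplies the cylinder length by at least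
  \<open>1/12\<close>, which explains the choice of the constant in \<open>luroth_words\<close>.\<close>
lemma luroth_distal_coding:
  assumes s: "0 < s" "s < 1"
  obtains C g where "C > 0" "\<And>t. g t \<in> luroth_distal x \<inter> {0<..1}"
    "\<And>t t'. t \<in> {0..<1} \<Longrightarrow> t' \<in> {0..<1} \<Longrightarrow> C * \<bar>t - t'\<bar> \<le> dist (g t) (g t') powr s"
proof -
  obtain M n :: nat and R W where M: "M \<ge> 4" and R: "R \<ge> 1" and W: "finite W" "W \<subseteq> ({..<n} \<rightarrow>\<^sub>E {2..M})"
    and WR: "\<And>w. w \<in> W \<Longrightarrow> (\<Prod>i<n. luroth_slope (w i)) = R" and cardW: "12 powr s * R powr s \<le> real (card W)"
    by (rule luroth_words[OF s, of "12 powr s"]) (rule that)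
  define N where "N = card W"
  have "1 < (12::real) powr s" using s by simp
  moreover have "1 \<le> R powr s" using R s by (intro ge_one_powr_ge_zero) auto
  ultimately have "1 < 12 powr s * R powr s" using mult_mono[of 1 "12 powr s" 1 "R powr s"] by (smt (verit) mult_le_cancel_left1)
  then have "1 < real N" using cardW by (simp add: N_def)
  then have N: "N \<ge> 2" by simp
  have RN: "(12 * R) powr s \<le> real N"
    using cardW R by (simp add: N_def powr_mult)
  obtain e where "bij_betw e {0..<N} W" using ex_bij_betw_nat_finite[OF W(1)] N_def by blast
  then have e_inj: "inj_on e {..<N}" and e_W: "\<And>c. c < N \<Longrightarrow> e c \<in> W"
    by (auto simp: bij_betw_def lessThan_atLeast0)
  define forced where "forced m = (if (luroth_map ^^ m) x \<in> luroth_inv 3 ` {0<..1} then 4 else 3 :: nat)" for m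
  define dg where "dg t m = (if m mod Suc n < n then e (base_digit N t (m div Suc n)) (m mod Suc n) else forced m)" for t m
  have c_less: "base_digit N t j < N" for t j using N by (simp add: base_digit_def)
  have divmod: "(j * K + i) mod K = i" "(j * K + i) div K = j" if "i < K" for i j K :: nat
    using that by auto
  have word: "dg t (j * Suc n + i) = e (base_digit N t j) i" if "i < n" for t j i
    using that by (simp only: dg_def divmod[OF less_SucI[OF that]] if_True)
  have last: "dg t (j * Suc n + n) = forced (j * Suc n + n)" for t j
    by (simp only: dg_def divmod[OF lessI] less_irrefl if_False)
  have dg_bounds: "2 \<le> dg t m \<and> dg t m \<le> M" for t m
  proof (cases "m mod Suc n < n")
    case True
    have "e (base_digit N t (m div Suc n)) \<in> {..<n} \<rightarrow>\<^sub>E {2..M}"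
      using e_W[OF c_less] W(2) by blast
    then have "e (base_digit N t (m div Suc n)) (m mod Suc n) \<in> {2..M}" using True by (auto simp: PiE_def Pi_def)
    with True show ?thesis by (simp add: dg_def)
  qed (use M in \<open>simp add: dg_def forced_def\<close>)
  then have dg2: "2 \<le> dg t m" for t m by simp
  \<comment> \<open>From every time \<open>m\<close> an inserted digit comes up within
    \<open>n\<close> steps.\<close>
  have reach: "\<exists>i\<le>n. \<exists>j. m + i = j * Suc n + n" for m
  proof -
    have "m + (n - m mod Suc n) = m div Suc n * Suc n + n"
      using mod_less_divisor[of "Suc n" m] div_mult_mod_eq[of m "Suc n"] by linarith
    then show ?thesis by (metis diff_le_self)
  qed
  \<comment> \<open>Digits at most \<open>M\<close> keep the orbit above 1/M; an inserted digit,
    never 2, among the next n + 1 digits keeps it below 1 - 1/2^(n+1).\<close>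
  define c where "c = min (1 / real M) (1 / 2 ^ Suc n)"
  have c: "c > 0" using M by (simp add: c_def)
  have mid: "luroth_val (\<lambda>i. dg t (m + i)) \<in> {c..1 - c}" for t m
  proof -
    obtain i j where i: "i \<le> n" "m + i = j * Suc n + n" using reach by blast
    have "luroth_val (\<lambda>i. dg t (m + i)) \<le> 1 - 1 / 2 ^ Suc i"
      using dg2 i last[of t j] by (intro luroth_val_less_1) (auto simp: forced_def)
    moreover have "(1::real) / 2 ^ Suc n \<le> 1 / 2 ^ Suc i"
      using i by (intro divide_left_mono power_increasing) auto
    moreover have "1 / real M \<le> luroth_val (\<lambda>i. dg t (m + i))"
    proof -
      have "1 / real M \<le> 1 / real (dg t m)"
        using dg_bounds[of t m] M by (intro divide_left_mono) auto
      also have "\<dots> \<le> luroth_val (\<lambda>i. dg t (m + i))"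
        using dg2 luroth_val_bounds[of "\<lambda>i. dg t (m + Suc i)"] 
        by (subst luroth_val_rec) (auto intro!: less_imp_le[OF luroth_inv_bounds(1)])
      finally show ?thesis .
    qed
    moreover have "c \<le> 1 / real M" "c \<le> 1 / 2 ^ Suc n" unfolding c_def by auto
    ultimately show ?thesis unfolding atLeastAtMost_iff by linarith
  qed
  define \<delta> where "\<delta> = c / luroth_slope M ^ Suc n"
  have M2: "luroth_slope M \<ge> 2" using M by (intro luroth_slope_ge2) auto
  then have \<delta>: "\<delta> > 0" using c by (simp add: \<delta>_def)
  have sep: "\<delta> \<le> \<bar>z - luroth_val (\<lambda>k. dg t (m + k))\<bar>"
    if "i \<le> n" "(luroth_map ^^ i) z \<notin> luroth_inv (dg t (m + i)) ` {0<..1}" for z t m i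
  proof -
    have "\<delta> \<le> c / luroth_slope M ^ Suc i"
      unfolding \<delta>_def using that(1) c M2 by (intro divide_left_mono power_increasing) auto
    also have "\<dots> \<le> \<bar>z - luroth_val (\<lambda>k. dg t (m + k))\<bar>"
    proof (rule luroth_val_separation)
      show "luroth_val (\<lambda>k'. dg t (m + (k + k'))) \<in> {c..1 - c}" for k
        using mid[of t "m + k"] by (simp add: add.assoc)
    qed (use dg_bounds c that in auto)
    finally show ?thesis .
  qed
  define g where "g t = luroth_val (dg t)" for t
  have g_orbit: "(luroth_map ^^ m) (g t) = luroth_val (\<lambda>k. dg t (m + k))" for m t
    unfolding g_def using dg2 by (rule luroth_map_funpow_val)
  have g01: "g t \<in> {0<..1}" for t unfolding g_def using dg2 by (rule luroth_val_bounds)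
  have "g t \<in> luroth_distal x" for t
  proof (rule luroth_distalI[OF _ \<delta>])
    fix m
    obtain i j where i: "i \<le> n" "m + i = j * Suc n + n" using reach by blast
    have "(luroth_map ^^ (m + i)) x \<notin> luroth_inv (forced (m + i)) ` {0<..1}"
      using luroth_branch_disjoint[of 3 4] by (simp add: forced_def)
    then have "(luroth_map ^^ i) ((luroth_map ^^ m) x) \<notin> luroth_inv (dg t (m + i)) ` {0<..1}"
      using last[of t j] i by (simp add: funpow_add add.commute[of m])
    then show "\<delta> \<le> \<bar>(luroth_map ^^ m) x - (luroth_map ^^ m) (g t)\<bar>"
      unfolding g_orbit using i by (intro sep)
  qed (use g01[of t] in auto)
  moreover have "\<delta> powr s * \<bar>t - t'\<bar> \<le> dist (g t) (g t') powr s"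
    if t: "t \<in> {0..<1}" "t' \<in> {0..<1}" for t t'
  proof (cases "t = t'")
    case False
    obtain j where j: "base_digit N t j \<noteq> base_digit N t' j"
      and jl: "\<And>i. i < j \<Longrightarrow> base_digit N t i = base_digit N t' i"
      using base_digit_differ[OF t False N] by blast
    have close: "\<bar>t - t'\<bar> \<le> 1 / real N ^ j"
      using base_digit_close[OF t _ jl] N by simp
    have same: "dg t i = dg t' i" if "i < j * Suc n" for i
      using jl[of "i div Suc n"] that by (simp add: dg_def div_less_iff_less_mult del: mult_Suc_right)
    \<comment> \<open>Each full block contributes \<open>R\<close> from its word and at most 4 * 3 =
      12 from its inserted digit.\<close>
    have prod: "(\<Prod>i<j * Suc n. luroth_slope (dg t i)) \<le> (12 * R) ^ j"
    proof -
      have "(\<Prod>i<j * Suc n. luroth_slope (dg t i)) =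
          (\<Prod>m<j. \<Prod>i\<in>{m * Suc n..<m * Suc n + Suc n}. luroth_slope (dg t i))"
        by (rule prod.nat_group[symmetric])
      also have "\<dots> \<le> (\<Prod>m<j. 12 * R)"
      proof (rule prod_mono, rule conjI)
        fix m
        show "0 \<le> (\<Prod>i\<in>{m * Suc n..<m * Suc n + Suc n}. luroth_slope (dg t i))"
          using luroth_slope_pos[OF dg2] by (intro prod_nonneg) (auto intro: less_imp_le)
        have "(\<Prod>i\<in>{m * Suc n..<m * Suc n + Suc n}. luroth_slope (dg t i)) =
            (\<Prod>i<Suc n. luroth_slope (dg t (m * Suc n + i)))"
          using prod.shift_bounds_nat_ivl[of "\<lambda>i. luroth_slope (dg t i)" 0 "m * Suc n" "Suc n"]
          by (simp add: lessThan_atLeast0 add.commute)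
        also have "\<dots> = (\<Prod>i<n. luroth_slope (dg t (m * Suc n + i))) * luroth_slope (dg t (m * Suc n + n))"
          by simp
        also have "(\<Prod>i<n. luroth_slope (dg t (m * Suc n + i))) = R"
          using WR[OF e_W[OF c_less[of t m]]] word[of _ t m] by simp
        also have "luroth_slope (dg t (m * Suc n + n)) \<le> 12"
          unfolding last forced_def luroth_slope_def by simp
        finally show "(\<Prod>i\<in>{m * Suc n..<m * Suc n + Suc n}. luroth_slope (dg t i)) \<le> 12 * R"
          using R by (simp add: mult_left_mono mult.commute)
      qed
      finally show ?thesis by simp
    qed
    have "e (base_digit N t j) \<noteq> e (base_digit N t' j)"
      using j c_less e_inj by (auto simp: inj_on_def)
    then obtain i where i: "i < n" "e (base_digit N t j) i \<noteq> e (base_digit N t' j) i"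
      using e_W[OF c_less] W(2) by (metis PiE_ext lessThan_iff subsetD)
    \<comment> \<open>The separation bound is reused with the orbit of \<open>g t'\<close> in place
      of that of \<open>x\<close>: in block \<open>j\<close> the two words differ at position
      \<open>i\<close>.\<close>
    have "\<delta> \<le> \<bar>luroth_val (\<lambda>k. dg t' (j * Suc n + k)) - luroth_val (\<lambda>k. dg t (j * Suc n + k))\<bar>"
    proof (rule sep)
      show "i \<le> n" using i by simp
      have "(luroth_map ^^ i) (luroth_val (\<lambda>k. dg t' (j * Suc n + k))) =
          luroth_val (\<lambda>k. dg t' (j * Suc n + (i + k)))"
        using dg2 by (rule luroth_map_funpow_val)
      also have "\<dots> = luroth_inv (dg t' (j * Suc n + i)) (luroth_val (\<lambda>k. dg t' (j * Suc n + (i + Suc k))))"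
        using dg2 by (subst luroth_val_rec) auto
      also have "\<dots> \<notin> luroth_inv (dg t (j * Suc n + i)) ` {0<..1}"
      proof (rule luroth_branch_disjoint[OF dg2 dg2])
        show "dg t' (j * Suc n + i) \<noteq> dg t (j * Suc n + i)" using i(2) word[OF i(1)] by metis
      qed (intro imageI luroth_val_bounds dg2)
      finally show "(luroth_map ^^ i) (luroth_val (\<lambda>k. dg t' (j * Suc n + k))) \<notin>
          luroth_inv (dg t (j * Suc n + i)) ` {0<..1}" .
    qed
    then have "\<delta> / (12 * R) ^ j \<le>
        \<bar>luroth_val (\<lambda>k. dg t (j * Suc n + k)) - luroth_val (\<lambda>k. dg t' (j * Suc n + k))\<bar> /
          (\<Prod>i<j * Suc n. luroth_slope (dg t i))"
      using prod \<delta> luroth_slope_pos[OF dg2]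
      by (intro frac_le prod_pos) (auto simp: abs_minus_commute)
    also have "\<dots> = dist (g t) (g t')"
      unfolding g_def dist_real_def
      using luroth_val_diff[OF dg2 dg2 same] luroth_slope_pos[OF dg2]
      by (simp add: abs_of_pos prod_pos del: mult_Suc_right)
    finally have dist: "\<delta> / (12 * R) ^ j \<le> dist (g t) (g t')" .
    have "\<delta> powr s * \<bar>t - t'\<bar> \<le> \<delta> powr s / real N ^ j"
      using mult_left_mono[OF close, of "\<delta> powr s"] by simp
    \<comment> \<open>The abundance of words, \<open>(12 * R) powr s <= N\<close>, makes the base
      \<open>N\<close> scale no larger than the \<open>s\<close>-th power of the cylinder
      scale.\<close>
    also have "\<dots> \<le> \<delta> powr s / ((12 * R) powr s) ^ j"
      using RN R N by (intro divide_left_mono power_mono mult_pos_pos) auto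
    also have "\<dots> = (\<delta> / (12 * R) ^ j) powr s"
    proof -
      have "(q powr s) ^ j = (q ^ j) powr s" if "q > 0" for q :: real
        using that by (simp add: powr_power powr_powr mult.commute flip: powr_realpow)
      from this[of "12 * R"] show ?thesis using \<delta> R by (simp add: powr_divide)
    qed
    also have "\<dots> \<le> dist (g t) (g t') powr s"
      using dist \<delta> R s by (intro powr_mono2) auto
    finally show ?thesis .
  qed simp
  moreover have "\<delta> powr s > 0" using \<delta> by simp
  ultimately show ?thesis using that[of "\<delta> powr s" g] g01 by blast
qed

section \<open>Density of the distal set\<close>

lemma luroth_distal_pullback:
  assumes "a \<ge> 2" "w \<in> luroth_distal (luroth_map x)" "w \<in> {0<..1}"
  shows "luroth_inv a w \<in> luroth_distal x"
proof -
  let ?y = "luroth_inv a w"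
  let ?f = "\<lambda>n. ereal \<bar>(luroth_map ^^ n) x - (luroth_map ^^ n) ?y\<bar>"
  have "(\<lambda>n. ?f (n + 1)) = (\<lambda>n. ereal \<bar>(luroth_map ^^ n) (luroth_map x) - (luroth_map ^^ n) w\<bar>)"
    using luroth_map_inv[OF assms(1,3)] by (simp add: funpow_Suc_right del: funpow.simps)
  then have "0 < liminf (\<lambda>n. ?f (n + 1))"
    using assms(2) by (simp add: luroth_distal_def)
  \<comment> \<open>The lower limit ignores the first term, so one step of both orbits can be
    undone, along any branch for \<open>w\<close>.\<close>
  also have "liminf (\<lambda>n. ?f (n + 1)) = liminf ?f" by (rule liminf_shift_k)
  finally have "0 < liminf ?f" .
  moreover from this have "?y \<noteq> x" by (auto simp: Liminf_const)
  ultimately show ?thesis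
    using luroth_inv_bounds(3)[OF assms(1,3)] by (simp add: luroth_distal_def)
qed

text \<open>A distal point for the \<open>n\<close>-th iterate of \<open>x\<close> is pulled back
  along the first \<open>n\<close> digits of \<open>y\<close>; each inverse branch at least halves
  the distance.\<close>

lemma luroth_distal_approx:
  assumes "y \<in> {0<..1}"
  shows "\<exists>z\<in>luroth_distal x \<inter> {0<..1}. \<bar>z - y\<bar> \<le> 1 / 2 ^ n"
  using assms
proof (induction n arbitrary: x y)
  case 0
  \<comment> \<open>Only the existence of a distal point in (0,1] matters here; 1/2 is an arbitrary
    exponent.\<close>
  obtain C and g :: "real \<Rightarrow> real" where g: "\<And>t. g t \<in> luroth_distal x \<inter> {0<..1}"
    by (rule luroth_distal_coding[of "1 / 2" x]) auto
  show ?case using g[of 0] 0 by (intro bexI[of _ "g 0"]) auto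
next
  case (Suc n)
  obtain a u where a: "a \<ge> 2" "u \<in> {0<..1}" "y = luroth_inv a u"
    using luroth_inv_cases[OF Suc.prems] .
  obtain w where w: "w \<in> luroth_distal (luroth_map x)" "w \<in> {0<..1}" "\<bar>w - u\<bar> \<le> 1 / 2 ^ n"
    using Suc.IH[OF a(2)] by blast
  have "\<bar>luroth_inv a w - y\<bar> = \<bar>w - u\<bar> / luroth_slope a"
    using luroth_slope_pos[OF a(1)] by (simp add: a luroth_inv_diff)
  also have "\<dots> \<le> (1 / 2 ^ n) / 2"
    using w luroth_slope_ge2[OF a(1)] by (intro frac_le) auto
  finally show ?case
    using luroth_distal_pullback[OF a(1) w(1,2)] luroth_inv_bounds(3)[OF a(1) w(2)]
    by (intro bexI[of _ "luroth_inv a w"]) (auto simp: mult.commute)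
qed

lemma closure_luroth_distal: "closure (luroth_distal x) = {0..1}"
proof
  show "closure (luroth_distal x) \<subseteq> {0..1}"
    by (intro closure_minimal) (auto simp: luroth_distal_def)
  have "{0<..<1} \<subseteq> closure (luroth_distal x)"
  proof
    fix y :: real assume y: "y \<in> {0<..<1}"
    show "y \<in> closure (luroth_distal x)"
      unfolding closure_approachable
    proof (intro allI impI)
      fix e :: real assume "e > 0"
      then obtain n where n: "(1 / 2) ^ n < e" using real_arch_pow_inv[of e "1 / 2"] by auto
      obtain z where "z \<in> luroth_distal x" "\<bar>z - y\<bar> \<le> 1 / 2 ^ n"
        using luroth_distal_approx[of y x n] y by auto
      with n show "\<exists>z\<in>luroth_distal x. dist z y < e"
        by (intro bexI[of _ z]) (auto simp: dist_real_def power_one_over)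
    qed
  qed
  then have "closure {0<..<1} \<subseteq> closure (luroth_distal x)"
    by (rule closure_minimal) simp
  then show "{0..1} \<subseteq> closure (luroth_distal x)" by simp
qed

section \<open>Dimension one and the conclusion\<close>

lemma hausdorff_dim_luroth_distal: "hausdorff_dim (luroth_distal x) = 1"
proof (rule antisym)
  show "hausdorff_dim (luroth_distal x) \<le> 1"
    by (rule hausdorff_dim_unit_interval_le) (auto simp: luroth_distal_def)
  have "1 \<le> s" if s: "s \<ge> 0" "hausdorff_outer_measure s (luroth_distal x) = 0" for s
  proof (rule ccontr)
    assume "\<not> 1 \<le> s"
    \<comment> \<open>The coding requires a positive exponent, so counting measure is treated
      apart.\<close>
    then consider "s = 0" | "0 < s" "s < 1" using s by linarith
    then show False
    proof cases
      case 1
      moreover have "luroth_distal x \<noteq> {}" using closure_luroth_distal[of x] by auto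
      ultimately show False using s(2) hausdorff_outer_measure_0_pos by blast
    next
      case 2
      obtain C g where C: "C > 0" and g: "\<And>t. g t \<in> luroth_distal x \<inter> {0<..1}"
        and ex: "\<And>t t'. t \<in> {0..<1} \<Longrightarrow> t' \<in> {0..<1} \<Longrightarrow> C * \<bar>t - t'\<bar> \<le> dist (g t) (g t') powr s"
        using luroth_distal_coding[OF 2, of x] by blast
      show False
        using hausdorff_outer_measure_pos[OF 2(1) C _ ex, of "luroth_distal x"] g s(2) by blast
    qed
  qed
  then show "1 \<le> hausdorff_dim (luroth_distal x)"
    unfolding hausdorff_dim_def by (intro Inf_greatest) (auto simp: ennreal_1[symmetric] simp del: ennreal_1 intro!: ennreal_leI)
qed

theorem theorem2:
  fixes x :: real
  assumes "x \<in> {0..1}"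
  shows "closure (luroth_distal x) = {0..1}
    \<and> luroth_distal x \<in> null_sets (lebesgue_on {0..1})
    \<and> hausdorff_dim (luroth_distal x) = 1"
  using closure_luroth_distal luroth_distal_null[OF assms] hausdorff_dim_luroth_distal by blast

end
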